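(* Let $G=(V,E)$ be a tournament graph on $m$ teams, $c$ a single-elimination cup over $V$ that is a perfect binary tree with fixed, known seeding, $C\subseteq V$ a coalition, and $v_w\in V$ a team. The modified CSL algorithm (described in the context), in which at every node $s^{v_i}_n$ the team selected to lose to $v_i$ is the one that minimizes the value of $m(v_i,s^{v_i}_n)$, calculates in polynomial time the minimal number of manipulations by $C$ needed to constructively manipulate the cup (make $v_w$ win), and the minimal number needed to destructively manipulate it (make $v_w$ not win).
   Context: A tournament is a directed graph $G=(V,E)$ whose underlying undirected graph is complete, with exactly one directed edge between any two distinct teams; $(v_i,v_j)\in E$ means that $v_i$ beats $v_j$ in a fair game. A manipulation replaces an edge $(v_i,v_j)$ by $(v_j,v_i)$; it is allowed only if $v_i\in C$. The set of manipulable edges is $M=\{(v_i,v_j)\in E: v_i\in C\}$. The cup is a perfect binary tree whose leaves are labelled bijectively by the teams; each internal node is a game between the winners of its two child subtrees (a leaf's winner is its team), decided by the (manipulated) tournament graph, and the winner at the root wins the cup. The level of a node is its height above the leaves (leaves have level $0$); $s^{v_i}_\ell$ denotes the node of level $\ell$ whose subtree contains the leaf $v_i$ (for $\ell=0$, the leaf itself). Put $c_{ij}=1$ if $(v_j,v_i)\in M$ and $c_{ij}=0$ otherwise, and let $D_i$ be the set of teams $v_j$ that $v_i$ can defeat, i.e. $(v_i,v_j)\in E$ or $(v_j,v_i)\in M$. Define $m(v_i,s^{v_i}_0)=0$, and for $\ell>0$ $$m(v_i,s^{v_i}_\ell)=m(v_i,s^{v_i}_{\ell-1})+\min_{v_j}\bigl(m(v_j,s^{v_j}_{\ell-1})+c_{ij}\bigr),$$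 where the minimum is over the $v_j\in D_i$ that are possible winners (via manipulation) of the child of $s^{v_i}_\ell$ not containing $v_i$; the minimum over the empty set is $+\infty$. Modified CSL algorithm: working from the leaves to the root, compute for each node the set of possible winners via manipulation, namely each possible winner $v_i$ of one child for which some possible winner $v_j$ of the other child satisfies $v_j\in D_i$ (the possible winner of a leaf is its own team); together with each possible winner $v_i$, store the value $m(v_i,\cdot)$ at that node, choosing as the opponent losing to $v_i$ the one attaining the minimum. With $r$ the root, it returns $m(v_w,r)$ for constructive manipulation and $\min_{v\ne v_w} m(v,r)$ for destructive manipulation. A value $+\infty$ means that no manipulation achieves the goal. *)

theory Defs
  imports
    "HOL-Library.Extended_Nat"
    "HOL-Library.Monad_Syntax"
    "HOL-Computational_Algebra.Polynomial"
begin

section \<open>Tournaments, cups and manipulations\<close>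

definition tournament :: "'v set \<Rightarrow> ('v \<times> 'v) set \<Rightarrow> bool" where
  "tournament V E \<longleftrightarrow> finite V \<and> E \<subseteq> V \<times> V \<and> asym E \<and> total_on V E"

datatype 'v cup = Team 'v | Game "'v cup" "'v cup"

primrec leaves :: "'v cup \<Rightarrow> 'v list" where
  "leaves (Team v) = [v]"
| "leaves (Game l r) = leaves l @ leaves r"

primrec level :: "'v cup \<Rightarrow> nat" where
  "level (Team v) = 0"
| "level (Game l r) = Suc (max (level l) (level r))"

primrec perfect :: "'v cup \<Rightarrow> bool" where
  "perfect (Team v) \<longleftrightarrow> True"
| "perfect (Game l r) \<longleftrightarrow> perfect l \<and> perfect r \<and> level l = level r"

definition cup_over :: "'v set \<Rightarrow> 'v cup \<Rightarrow> bool" where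
  "cup_over V c \<longleftrightarrow> perfect c \<and> distinct (leaves c) \<and> set (leaves c) = V"

primrec winner :: "('v \<times> 'v) set \<Rightarrow> 'v cup \<Rightarrow> 'v" where
  "winner E (Team v) = v"
| "winner E (Game l r) =
    (if (winner E l, winner E r) \<in> E then winner E l else winner E r)"

definition manipulable :: "('v \<times> 'v) set \<Rightarrow> 'v set \<Rightarrow> ('v \<times> 'v) set" where
  "manipulable E C = {(u, v). (u, v) \<in> E \<and> u \<in> C}"

definition manipulate :: "('v \<times> 'v) set \<Rightarrow> ('v \<times> 'v) set \<Rightarrow> ('v \<times> 'v) set" where
  "manipulate E S = (E - S) \<union> S\<inverse>"

text \<open>The infimum of the empty set in \<^typ>\<open>enat\<close> is \<open>\<infinity>\<close>.\<close>

definition min_constructive ::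
    "('v \<times> 'v) set \<Rightarrow> 'v set \<Rightarrow> 'v cup \<Rightarrow> 'v \<Rightarrow> enat" where
  "min_constructive E C c w =
    (INF S \<in> {S. S \<subseteq> manipulable E C \<and> winner (manipulate E S) c = w}. enat (card S))"

definition min_destructive ::
    "('v \<times> 'v) set \<Rightarrow> 'v set \<Rightarrow> 'v cup \<Rightarrow> 'v \<Rightarrow> enat" where
  "min_destructive E C c w =
    (INF S \<in> {S. S \<subseteq> manipulable E C \<and> winner (manipulate E S) c \<noteq> w}. enat (card S))"


section \<open>The value of a team at a node\<close>

definition can_defeat :: "('v \<times> 'v) set \<Rightarrow> 'v set \<Rightarrow> 'v \<Rightarrow> 'v set" where
  "can_defeat E C v = {w. (v, w) \<in> E \<or> (w, v) \<in> manipulable E C}"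

definition bribe :: "('v \<times> 'v) set \<Rightarrow> 'v set \<Rightarrow> 'v \<Rightarrow> 'v \<Rightarrow> nat" where
  "bribe E C v w = (if (w, v) \<in> manipulable E C then 1 else 0)"

definition possible_winners :: "('v \<times> 'v) set \<Rightarrow> 'v set \<Rightarrow> 'v cup \<Rightarrow> 'v set" where
  "possible_winners E C c = {winner (manipulate E S) c | S. S \<subseteq> manipulable E C}"

text \<open>
  A node is identified with the subtree below it, so \<open>m_value E C s v\<close> is the value of \<open>v\<close> at
  the root of \<open>s\<close>; it is meaningful only if \<open>v\<close> is a leaf of \<open>s\<close>.
\<close>

primrec m_value :: "('v \<times> 'v) set \<Rightarrow> 'v set \<Rightarrow> 'v cup \<Rightarrow> 'v \<Rightarrow> enat" where
  "m_value E C (Team u) v = 0"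
| "m_value E C (Game l r) v =
    (if v \<in> set (leaves l)
     then m_value E C l v +
       (INF w \<in> can_defeat E C v \<inter> possible_winners E C r. m_value E C r w + enat (bribe E C v w))
     else m_value E C r v +
       (INF w \<in> can_defeat E C v \<inter> possible_winners E C l. m_value E C l w + enat (bribe E C v w)))"


section \<open>The algorithm, with running time\<close>

text \<open>
  A computation is a result together with the number of elementary steps spent on it. Every
  application of \<open>step\<close> below evaluates an expression consisting of boundedly many lookups
  (of an edge in the adjacency matrix \<open>E\<close>, or of a team in the coalition \<open>C\<close>), comparisons,
  additions and constructor applications or matches, and is charged one unit; every function
  call performs at least one step. All numbers that occur are at most the number of games of the
  cup, so unit cost for arithmetic is adequate.
\<close>

datatype 'a timed = Timed (result: 'a) (steps: nat)

definition step :: "'a \<Rightarrow> 'a timed" where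
  "step x = Timed x 1"

definition bind_timed :: "'a timed \<Rightarrow> ('a \<Rightarrow> 'b timed) \<Rightarrow> 'b timed" where
  "bind_timed p f =
    Timed (result (f (result p))) (steps p + steps (f (result p)))"

adhoc_overloading Monad_Syntax.bind \<rightleftharpoons> bind_timed

text \<open>
  A table lists the possible winners of a node, each with its stored value. \<open>best_loser E C v t\<close>
  selects from the table \<open>t\<close> of the sibling node an opponent that \<open>v\<close> can defeat and for which
  the stored value plus the cost of manipulating the game is minimal, and returns this opponent
  and this minimum.
\<close>

fun better :: "'v \<times> nat \<Rightarrow> ('v \<times> nat) option \<Rightarrow> 'v \<times> nat" where
  "better (w, k) None = (w, k)"
| "better (w, k) (Some (u, j)) = (if k \<le> j then (w, k) else (u, j))"

fun best_loser ::
    "('v \<times> 'v) set \<Rightarrow> 'v set \<Rightarrow> 'v \<Rightarrow> ('v \<times> nat) list \<Rightarrow> ('v \<times> nat) option timed" where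
  "best_loser E C v [] = step None"
| "best_loser E C v ((w, k) # t) = do {
    b \<leftarrow> best_loser E C v t;
    beatable \<leftarrow> step (w \<in> can_defeat E C v);
    if beatable then do {
      j \<leftarrow> step (k + bribe E C v w);
      step (Some (better (w, j) b))
    } else step b
  }"

text \<open>
  \<open>advance E C t t' acc\<close> adds to \<open>acc\<close> the teams of \<open>t\<close> that can defeat some team of \<open>t'\<close>, with
  their new values.
\<close>

fun advance ::
    "('v \<times> 'v) set \<Rightarrow> 'v set \<Rightarrow> ('v \<times> nat) list \<Rightarrow> ('v \<times> nat) list \<Rightarrow> ('v \<times> nat) list
      \<Rightarrow> ('v \<times> nat) list timed" where
  "advance E C [] t' acc = step acc"
| "advance E C ((v, k) # t) t' acc = do {
    b \<leftarrow> best_loser E C v t';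
    acc' \<leftarrow> step (case b of None \<Rightarrow> acc | Some (w, j) \<Rightarrow> (v, k + j) # acc);
    advance E C t t' acc'
  }"

fun csl_table :: "('v \<times> 'v) set \<Rightarrow> 'v set \<Rightarrow> 'v cup \<Rightarrow> ('v \<times> nat) list timed" where
  "csl_table E C (Team v) = step [(v, 0)]"
| "csl_table E C (Game l r) = do {
    tl \<leftarrow> csl_table E C l;
    tr \<leftarrow> csl_table E C r;
    acc \<leftarrow> advance E C tl tr [];
    advance E C tr tl acc
  }"

fun stored_value :: "'v \<Rightarrow> ('v \<times> nat) list \<Rightarrow> enat timed" where
  "stored_value w [] = step \<infinity>"
| "stored_value w ((v, k) # t) = do {
    found \<leftarrow> step (v = w);
    if found then step (enat k) else stored_value w t
  }"

fun least_other_value :: "'v \<Rightarrow> ('v \<times> nat) list \<Rightarrow> enat timed" where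
  "least_other_value w [] = step \<infinity>"
| "least_other_value w ((v, k) # t) = do {
    n \<leftarrow> least_other_value w t;
    step (if v = w then n else min (enat k) n)
  }"

definition csl_constructive ::
    "('v \<times> 'v) set \<Rightarrow> 'v set \<Rightarrow> 'v cup \<Rightarrow> 'v \<Rightarrow> enat timed" where
  "csl_constructive E C c w = do { t \<leftarrow> csl_table E C c; stored_value w t }"

definition csl_destructive ::
    "('v \<times> 'v) set \<Rightarrow> 'v set \<Rightarrow> 'v cup \<Rightarrow> 'v \<Rightarrow> enat timed" where
  "csl_destructive E C c w = do { t \<leftarrow> csl_table E C c; least_other_value w t }"

end

theory Submission
  imports Defs
begin

text \<open>
  The teams below the two children of a node are disjoint, so the games below the left child, the
  games below the right child and the game at the node itself are decided by disjoint sets of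
  edges. A manipulation making \<open>v\<close> win at the node therefore splits into one that makes \<open>v\<close> win
  its own child, one that makes some \<open>w\<close> win the other child, and, if needed, the reversal of
  \<open>(w, v)\<close>; conversely any such pieces combine without interfering. Hence the minimal numbers of
  manipulations obey the recursion of \<open>m_value\<close>. The table of a node holds exactly the pairs of a
  team and its finite value, and computing it at a node with \<open>a\<close> and \<open>b\<close> teams below its children
  takes \<open>O(a b)\<close> steps, which sums to a quadratic bound.
\<close>

section \<open>Winners of manipulated cups\<close>

lemma winner_in_leaves: "winner E c \<in> set (leaves c)"
  by (induction c) auto

lemma leaves_nonempty: "leaves c \<noteq> []"
  by (induction c) auto

text \<open>Only games between teams of the subtree are played in it. This locality makes the pieces
  of a manipulation independent.\<close>

lemma winner_cong:
  assumes "\<And>x y. x \<in> set (leaves c) \<Longrightarrow> y \<in> set (leaves c) \<Longrightarrow> (x, y) \<in> E \<longleftrightarrow> (x, y) \<in> F"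
  shows "winner E c = winner F c"
  using assms
proof (induction c)
  case (Game l r)
  have "winner E l = winner F l" "winner E r = winner F r"
    using Game by auto
  then show ?case
    using Game.prems winner_in_leaves[of F l] winner_in_leaves[of F r] by auto
qed simp

section \<open>Tournaments under manipulation\<close>

lemma tournament_asym: "tournament V E \<Longrightarrow> (x, y) \<in> E \<Longrightarrow> (y, x) \<notin> E"
  unfolding tournament_def by (meson asymD)

lemma tournament_total:
  "tournament V E \<Longrightarrow> x \<in> V \<Longrightarrow> y \<in> V \<Longrightarrow> x \<noteq> y \<Longrightarrow> (x, y) \<in> E \<or> (y, x) \<in> E"
  unfolding tournament_def total_on_def by blast

lemma tournament_finite_edges: "tournament V E \<Longrightarrow> finite E"
  unfolding tournament_def by (meson finite_SigmaI finite_subset)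

lemma manipulable_subset: "manipulable E C \<subseteq> E"
  by (auto simp: manipulable_def)

lemma finite_manipulation:
  "tournament V E \<Longrightarrow> S \<subseteq> manipulable E C \<Longrightarrow> finite S"
  using tournament_finite_edges manipulable_subset finite_subset by metis

lemma tournament_manipulate:
  assumes "tournament V E" "S \<subseteq> E"
  shows "tournament V (manipulate E S)"
proof -
  have "asym (manipulate E S)"
    using tournament_asym[OF assms(1)] assms(2)
    by (intro asymI) (auto simp: manipulate_def)
  moreover have "manipulate E S \<subseteq> V \<times> V" "total_on V (manipulate E S)" "finite V"
    using assms by (auto simp: tournament_def manipulate_def total_on_def)
  ultimately show ?thesis
    by (simp add: tournament_def)
qed

text \<open>\<open>winner\<close> favours the right child unless the left one beats it; this is
  symmetric because exactly one edge joins distinct teams. It reduces later arguments to teams of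
  the left child.\<close>

lemma winner_Game_commute:
  assumes "tournament V E" "distinct (leaves (Game l r))" "set (leaves (Game l r)) \<subseteq> V"
  shows "winner E (Game l r) = winner E (Game r l)"
proof -
  have "winner E l \<in> V" "winner E r \<in> V" "winner E l \<noteq> winner E r"
    using winner_in_leaves[of E l] winner_in_leaves[of E r] assms(2,3) by auto
  then show ?thesis
    using tournament_asym[OF assms(1)] tournament_total[OF assms(1)] by auto
qed

text \<open>Distinct leaves keep \<open>v\<close> from winning the right child, so the else branch
  of \<open>winner\<close> cannot yield \<open>v\<close>.\<close>

lemma winner_Game_left_iff:
  assumes "distinct (leaves (Game l r))" "v \<in> set (leaves l)"
  shows "winner E (Game l r) = v \<longleftrightarrow> winner E l = v \<and> (v, winner E r) \<in> E"
  using assms winner_in_leaves[of E r] by auto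


section \<open>Minimal numbers of manipulations\<close>

lemma enat_INF_attained:
  fixes f :: "'a \<Rightarrow> enat"
  assumes "A \<noteq> {}"
  obtains x where "x \<in> A" "(INF x\<in>A. f x) = f x"
proof -
  obtain x0 where "x0 \<in> A" using assms by blast
  then have "(INF x\<in>A. f x) \<in> f ` A"
    by (intro wellorder_InfI) auto
  then show thesis using that by auto
qed

lemma min_constructive_le:
  "S \<subseteq> manipulable E C \<Longrightarrow> winner (manipulate E S) c = v \<Longrightarrow> min_constructive E C c v \<le> card S"
  unfolding min_constructive_def by (rule INF_lower) simp

lemma min_constructive_attained:
  assumes "min_constructive E C c v \<noteq> \<infinity>"
  obtains S where "S \<subseteq> manipulable E C" "winner (manipulate E S) c = v"
    "min_constructive E C c v = card S"
proof -
  have "{S. S \<subseteq> manipulable E C \<and> winner (manipulate E S) c = v} \<noteq> {}"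
  proof
    assume "{S. S \<subseteq> manipulable E C \<and> winner (manipulate E S) c = v} = {}"
    then show False
      using assms unfolding min_constructive_def by (simp only:) (simp add: top_enat_def)
  qed
  then show thesis
    by (rule enat_INF_attained[of _ "\<lambda>S. enat (card S)"])
      (use that in \<open>auto simp: min_constructive_def\<close>)
qed

text \<open>Each \<open>card S\<close> is finite as an \<open>enat\<close>, so \<infinity> arises
  only as the infimum of the empty set.\<close>

lemma possible_winner_iff: "v \<in> possible_winners E C c \<longleftrightarrow> min_constructive E C c v \<noteq> \<infinity>"
proof
  assume "v \<in> possible_winners E C c"
  then obtain S where "S \<subseteq> manipulable E C" "winner (manipulate E S) c = v"
    by (auto simp: possible_winners_def)
  from min_constructive_le[OF this] show "min_constructive E C c v \<noteq> \<infinity>"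
    by (metis enat_ord_simps(5) infinity_ne_i0 enat.distinct(1))
next
  assume "min_constructive E C c v \<noteq> \<infinity>"
  then show "v \<in> possible_winners E C c"
    by (rule min_constructive_attained) (auto simp: possible_winners_def)
qed

lemma possible_winners_subset: "possible_winners E C c \<subseteq> set (leaves c)"
  by (auto simp: possible_winners_def winner_in_leaves)

section \<open>The recursion at a game\<close>

lemma min_constructive_Game_commute:
  assumes "tournament V E" "distinct (leaves (Game l r))" "set (leaves (Game l r)) \<subseteq> V"
  shows "min_constructive E C (Game l r) v = min_constructive E C (Game r l) v"
proof -
  have "winner (manipulate E S) (Game l r) = winner (manipulate E S) (Game r l)"
    if "S \<subseteq> manipulable E C" for S
    using winner_Game_commute[OF tournament_manipulate[OF assms(1)] assms(2,3)]
      that manipulable_subset by blast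
  then show ?thesis
    unfolding min_constructive_def by (intro INF_cong) (auto simp del: winner.simps)
qed

text \<open>\<open>S\<close> contains three disjoint pieces: its edges inside \<open>l\<close>,
  those inside \<open>r\<close>, and \<open>(w, v)\<close> if reversed. By
  \<open>winner_cong\<close> each of the first two alone secures its child.\<close>

lemma game_cost_lower:
  assumes "tournament V E" "distinct (leaves (Game l r))"
    and S: "S \<subseteq> manipulable E C"
    and v: "winner (manipulate E S) l = v"
    and w: "winner (manipulate E S) r = w"
    and beats: "(v, w) \<in> manipulate E S"
  shows "min_constructive E C l v + (min_constructive E C r w + bribe E C v w) \<le> card S"
proof -
  let ?L = "set (leaves l) \<times> set (leaves l)" and ?R = "set (leaves r) \<times> set (leaves r)"
  let ?G = "S \<inter> {(w, v)}"
  have fin: "finite S" by (rule finite_manipulation[OF assms(1) S])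
  have vl: "v \<in> set (leaves l)" and wr: "w \<in> set (leaves r)"
    using v w winner_in_leaves by auto
  have "winner (manipulate E (S \<inter> ?L)) l = v"
    unfolding v[symmetric] by (rule winner_cong) (auto simp: manipulate_def)
  then have l: "min_constructive E C l v \<le> card (S \<inter> ?L)"
    using S by (intro min_constructive_le) auto
  have "winner (manipulate E (S \<inter> ?R)) r = w"
    unfolding w[symmetric] by (rule winner_cong) (auto simp: manipulate_def)
  then have r: "min_constructive E C r w \<le> card (S \<inter> ?R)"
    using S by (intro min_constructive_le) auto
  \<comment> \<open>If \<open>(w, v)\<close> is in \<open>E\<close>, asymmetry excludes
    \<open>(v, w)\<close>, so \<open>v\<close> beats \<open>w\<close> only through the
    reversal.\<close>
  have "(w, v) \<in> S" if "(w, v) \<in> manipulable E C"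
    using that beats tournament_asym[OF assms(1)] manipulable_subset[of E C]
    by (auto simp: manipulate_def)
  then have g: "bribe E C v w \<le> card ?G"
    by (auto simp: bribe_def)
  have "card (S \<inter> ?L) + (card (S \<inter> ?R) + card ?G) = card (S \<inter> ?L \<union> (S \<inter> ?R \<union> ?G))"
    using fin vl wr assms(2) by (subst card_Un_disjoint; (subst card_Un_disjoint)?) auto
  also have "\<dots> \<le> card S"
    using fin by (intro card_mono) auto
  finally have "card (S \<inter> ?L) + (card (S \<inter> ?R) + card ?G) \<le> card S" .
  with g have "card (S \<inter> ?L) + (card (S \<inter> ?R) + bribe E C v w) \<le> card S"
    by linarith
  then have "enat (card (S \<inter> ?L)) + (enat (card (S \<inter> ?R)) + enat (bribe E C v w)) \<le> card S"
    by simp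
  with l r show ?thesis
    by (meson add_mono add_right_mono order_trans)
qed

lemma game_cost_upper:
  assumes "tournament V E" "distinct (leaves (Game l r))" "v \<in> set (leaves l)"
    and w: "w \<in> can_defeat E C v"
  shows "min_constructive E C (Game l r) v
    \<le> min_constructive E C l v + (min_constructive E C r w + bribe E C v w)"
proof (cases "min_constructive E C l v = \<infinity> \<or> min_constructive E C r w = \<infinity>")
  case False
  then have fin: "min_constructive E C l v \<noteq> \<infinity>" "min_constructive E C r w \<noteq> \<infinity>"
    by auto
  let ?L = "set (leaves l) \<times> set (leaves l)" and ?R = "set (leaves r) \<times> set (leaves r)"
  obtain S1 where S1: "S1 \<subseteq> manipulable E C" "winner (manipulate E S1) l = v"
      "min_constructive E C l v = card S1"
    by (rule min_constructive_attained[OF fin(1)])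
  obtain S2 where S2: "S2 \<subseteq> manipulable E C" "winner (manipulate E S2) r = w"
      "min_constructive E C r w = card S2"
    by (rule min_constructive_attained[OF fin(2)])
  have fin_S: "finite S1" "finite S2"
    using finite_manipulation[OF assms(1)] S1 S2 by auto
  have wr: "w \<in> set (leaves r)"
    using S2(2) winner_in_leaves by auto
  \<comment> \<open>\<open>G\<close> is empty exactly when no bribe is due. Cutting
    \<open>S1\<close> and \<open>S2\<close> down to their own subtrees keeps them from disturbing
    the other child or the game itself.\<close>
  define G where "G = manipulable E C \<inter> {(w, v)}"
  define S where "S = S1 \<inter> ?L \<union> (S2 \<inter> ?R \<union> G)"
  have S: "S \<subseteq> manipulable E C"
    using S1 S2 by (auto simp: S_def G_def)
  have "winner (manipulate E S) l = winner (manipulate E S1) l"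
    using assms(2,3) wr by (intro winner_cong) (auto simp: S_def G_def manipulate_def)
  moreover have wS: "winner (manipulate E S) r = winner (manipulate E S2) r"
    using assms(2,3) wr by (intro winner_cong) (auto simp: S_def G_def manipulate_def)
  \<comment> \<open>The pair \<open>(v, w)\<close> runs between the subtrees and lies in no piece of
    \<open>S\<close>, so such an edge of \<open>E\<close> survives; otherwise \<open>(w, v)\<close>
    is in \<open>G\<close> and gets reversed.\<close>
  moreover have "(v, w) \<in> manipulate E S"
    using w assms(2,3) wr by (auto simp: can_defeat_def manipulate_def S_def G_def manipulable_def)
  ultimately have "winner (manipulate E S) (Game l r) = v"
    using S1 S2 winner_Game_left_iff[OF assms(2,3)] by auto
  then have "min_constructive E C (Game l r) v \<le> card S"
    by (rule min_constructive_le[OF S])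
  also have "card S \<le> card S1 + (card S2 + bribe E C v w)"
  proof -
    have "card S \<le> card (S1 \<inter> ?L) + (card (S2 \<inter> ?R) + card G)"
      unfolding S_def by (meson add_left_mono card_Un_le order_trans)
    moreover have "card (S1 \<inter> ?L) \<le> card S1" "card (S2 \<inter> ?R) \<le> card S2"
      using fin_S by (auto intro: card_mono)
    moreover have "card G = bribe E C v w"
      by (auto simp: G_def bribe_def)
    ultimately show ?thesis by linarith
  qed
  finally show ?thesis using S1 S2 by simp
qed auto

text \<open>The upper bound glues optimal pieces for the cheapest opponent; the lower bound splits
  an optimal manipulation at the opponent that it actually sends up from \<open>r\<close>.\<close>

lemma min_constructive_Game_left:
  assumes "tournament V E" "distinct (leaves (Game l r))" "v \<in> set (leaves l)"
    and "set (leaves (Game l r)) \<subseteq> V"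
  shows "min_constructive E C (Game l r) v = min_constructive E C l v +
    (INF w \<in> can_defeat E C v \<inter> possible_winners E C r.
      min_constructive E C r w + enat (bribe E C v w))"
    (is "?lhs = ?a + (INF w \<in> ?A. ?f w)")
proof (rule antisym)
  show "?lhs \<le> ?a + (INF w \<in> ?A. ?f w)"
  proof (cases "?A = {}")
    case False
    then show ?thesis
      by (rule enat_INF_attained[of _ ?f]) (use game_cost_upper[OF assms(1-3)] in auto)
  qed (simp only: image_empty Inf_empty top_enat_def plus_enat_simps enat_ord_simps)
  show "?a + (INF w \<in> ?A. ?f w) \<le> ?lhs"
  proof (cases "?lhs = \<infinity>")
    case False
    then obtain S where S: "S \<subseteq> manipulable E C" "winner (manipulate E S) (Game l r) = v"
        "?lhs = card S"
      by (rule min_constructive_attained)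
    let ?w = "winner (manipulate E S) r"
    have v: "winner (manipulate E S) l = v" and beats: "(v, ?w) \<in> manipulate E S"
      using S(2) winner_Game_left_iff[OF assms(2,3)] by auto
    have "?w \<in> possible_winners E C r"
      using S(1) by (auto simp: possible_winners_def)
    moreover have "?w \<in> can_defeat E C v"
      using beats S(1) by (auto simp: can_defeat_def manipulate_def)
    ultimately have "?a + (INF w \<in> ?A. ?f w) \<le> ?a + ?f ?w"
      by (intro add_left_mono INF_lower) auto
    also have "\<dots> \<le> ?lhs"
      using game_cost_lower[OF assms(1,2) S(1) v refl beats] S(3) by simp
    finally show ?thesis .
  qed simp
qed

lemma min_constructive_Team: "min_constructive E C (Team u) u = 0"
  using min_constructive_le[of "{}" E C "Team u" u] by (simp add: zero_enat_def[symmetric])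

text \<open>Both sides obey the same recursion. That \<open>v\<close> is a leaf matters: at a leaf
  node \<open>m_value\<close> is 0 for every team.\<close>

lemma m_value_eq_min_constructive:
  assumes "tournament V E" "distinct (leaves c)" "set (leaves c) \<subseteq> V" "v \<in> set (leaves c)"
  shows "m_value E C c v = min_constructive E C c v"
  using assms(2-)
proof (induction c arbitrary: v)
  case (Team u)
  then show ?case by (simp add: min_constructive_Team)
next
  case (Game l r)
  note IH = Game.IH(1) Game.IH(2)
  \<comment> \<open>Possible winners are leaves of their subtree, so the induction hypothesis
    applies inside the infimum.\<close>
  have inf: "(INF w \<in> can_defeat E C v \<inter> possible_winners E C c. m_value E C c w + enat (bribe E C v w))
      = (INF w \<in> can_defeat E C v \<inter> possible_winners E C c.
          min_constructive E C c w + enat (bribe E C v w))"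
    if "c = l \<or> c = r" for c
    using that IH Game.prems possible_winners_subset[of E C c]
    by (intro INF_cong) auto
  show ?case
  proof (cases "v \<in> set (leaves l)")
    case True
    then show ?thesis
      using min_constructive_Game_left[OF assms(1) Game.prems(1) True Game.prems(2)] IH(1) inf
        Game.prems by simp
  next
    case False
    then have r: "v \<in> set (leaves r)" using Game.prems by simp
    have "distinct (leaves (Game r l))" "set (leaves (Game r l)) \<subseteq> V"
      using Game.prems by auto
    from min_constructive_Game_left[OF assms(1) this(1) r this(2)] False r
    show ?thesis
      using min_constructive_Game_commute[OF assms(1) Game.prems(1,2)] IH(2) inf Game.prems
      by simp
  qed
qed

text \<open>A manipulation stops \<open>w\<close> exactly if another leaf wins, so manipulations can
  be grouped by their winner.\<close>

lemma min_destructive_eq_INF: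
  "min_destructive E C c w = (INF v \<in> set (leaves c) - {w}. min_constructive E C c v)"
proof (rule antisym)
  show "min_destructive E C c w \<le> (INF v \<in> set (leaves c) - {w}. min_constructive E C c v)"
    unfolding min_destructive_def min_constructive_def
    by (intro INF_greatest INF_lower) auto
  show "(INF v \<in> set (leaves c) - {w}. min_constructive E C c v) \<le> min_destructive E C c w"
    unfolding min_destructive_def
    by (intro INF_greatest) (auto intro!: INF_lower2 min_constructive_le winner_in_leaves)
qed


section \<open>Results of the algorithm\<close>

lemma timed_simps [simp]:
  "result (step x) = x"
  "steps (step x) = 1"
  "result (bind_timed p f) = result (f (result p))"
  "steps (bind_timed p f) = steps p + steps (f (result p))"
  by (simp_all add: step_def bind_timed_def)

text \<open>Reading \<open>None\<close> as \<infinity>, the neutral element of the minimum, turns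
  the scan into an infimum and hides which of several optimal opponents was chosen.\<close>

lemma best_loser_value:
  "(case result (best_loser E C v t) of None \<Rightarrow> \<infinity> | Some (u, j) \<Rightarrow> enat j) =
    (INF (w, k) \<in> {(w, k) \<in> set t. w \<in> can_defeat E C v}. enat (k + bribe E C v w))"
proof (induction t)
  case Nil
  show ?case by (simp add: top_enat_def)
next
  case (Cons p t)
  obtain w k where p: "p = (w, k)" by fastforce
  have *: "{(u, j) \<in> set (p # t). u \<in> can_defeat E C v} =
      (if w \<in> can_defeat E C v then {(w, k)} else {}) \<union> {(u, j) \<in> set t. u \<in> can_defeat E C v}"
    by (auto simp: p)
  show ?case
    unfolding * INF_union Cons.IH[symmetric]
    by (auto simp: p top_enat_def inf_enat_def min_def split: option.splits)
qed

section \<open>Tables as graphs of the finite minimal values\<close>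

lemma set_advance:
  "set (result (advance E C t t' acc)) = set acc \<union>
    {(v, k + j) | v k w j. (v, k) \<in> set t \<and> result (best_loser E C v t') = Some (w, j)}"
  by (induction E C t t' acc rule: advance.induct) (auto split: option.splits)

text \<open>By \<open>possible_winner_iff\<close> the finite values belong exactly to the possible
  winners, so the infimum over entries becomes one over teams.\<close>

lemma best_loser_value_table:
  assumes t: "\<And>w k. (w, k) \<in> set t \<longleftrightarrow> min_constructive E C c w = enat k"
  shows "(case result (best_loser E C v t) of None \<Rightarrow> \<infinity> | Some (u, j) \<Rightarrow> enat j) =
    (INF w \<in> can_defeat E C v \<inter> possible_winners E C c.
      min_constructive E C c w + enat (bribe E C v w))"
proof -
  let ?A = "can_defeat E C v \<inter> possible_winners E C c"
  have "{(w, k) \<in> set t. w \<in> can_defeat E C v} =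
      (\<lambda>w. (w, the_enat (min_constructive E C c w))) ` ?A"
    by (force simp: t possible_winner_iff)
  then have "(INF (w, k) \<in> {(w, k) \<in> set t. w \<in> can_defeat E C v}. enat (k + bribe E C v w)) =
      (INF w \<in> ?A. enat (the_enat (min_constructive E C c w) + bribe E C v w))"
    by (simp add: image_image)
  also have "\<dots> = (INF w \<in> ?A. min_constructive E C c w + enat (bribe E C v w))"
    by (intro INF_cong) (auto simp: possible_winner_iff simp flip: plus_enat_simps)
  finally show ?thesis
    by (simp add: best_loser_value)
qed

lemma min_constructive_outside:
  "v \<notin> set (leaves c) \<Longrightarrow> min_constructive E C c v = \<infinity>"
  using possible_winner_iff possible_winners_subset by fast

text \<open>The sum in \<open>min_constructive_Game_left\<close> is finite iff both summands are,
  which is precisely when \<open>advance\<close> creates an entry for \<open>v\<close>.\<close>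

lemma advance_from_left:
  assumes "tournament V E" "distinct (leaves (Game l r))" "set (leaves (Game l r)) \<subseteq> V"
    and t: "\<And>w k. (w, k) \<in> set t \<longleftrightarrow> min_constructive E C l w = enat k"
    and t': "\<And>w k. (w, k) \<in> set t' \<longleftrightarrow> min_constructive E C r w = enat k"
  shows "(\<exists>k w j. n = k + j \<and> (v, k) \<in> set t \<and> result (best_loser E C v t') = Some (w, j)) \<longleftrightarrow>
    v \<in> set (leaves l) \<and> min_constructive E C (Game l r) v = enat n"
proof (cases "v \<in> set (leaves l)")
  case True
  let ?o = "case result (best_loser E C v t') of None \<Rightarrow> \<infinity> | Some (u, j) \<Rightarrow> enat j"
  have "min_constructive E C (Game l r) v = min_constructive E C l v + ?o"
    unfolding best_loser_value_table[OF t']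
    by (rule min_constructive_Game_left[OF assms(1,2) True assms(3)])
  with True show ?thesis
    by (cases "min_constructive E C l v") (auto simp: t split: option.splits)
qed (auto simp: t min_constructive_outside)

text \<open>The invariant of the bottom-up computation. The second \<open>advance\<close> handles
  the right child as the left child of the mirrored game.\<close>

lemma set_csl_table:
  assumes "tournament V E" "distinct (leaves c)" "set (leaves c) \<subseteq> V"
  shows "(v, k) \<in> set (result (csl_table E C c)) \<longleftrightarrow> min_constructive E C c v = enat k"
  using assms(2,3)
proof (induction c arbitrary: v k)
  case (Team u)
  then show ?case
    by (cases "v = u") (auto simp: min_constructive_Team min_constructive_outside zero_enat_def)
next
  case (Game l r)
  have IH: "(v, k) \<in> set (result (csl_table E C l)) \<longleftrightarrow> min_constructive E C l v = enat k"
      "(v, k) \<in> set (result (csl_table E C r)) \<longleftrightarrow> min_constructive E C r v = enat k" for v k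
    using Game by auto
  have sym: "distinct (leaves (Game r l))" "set (leaves (Game r l)) \<subseteq> V"
    using Game.prems by auto
  have "(v, k) \<in> set (result (csl_table E C (Game l r))) \<longleftrightarrow>
      v \<in> set (leaves l) \<and> min_constructive E C (Game l r) v = enat k \<or>
      v \<in> set (leaves r) \<and> min_constructive E C (Game r l) v = enat k"
    unfolding advance_from_left[OF assms(1) Game.prems IH, symmetric]
      advance_from_left[OF assms(1) sym IH(2) IH(1), symmetric]
    by (auto simp: set_advance)
  then show ?case
    using min_constructive_Game_commute[OF assms(1) Game.prems]
      min_constructive_outside[of v "Game l r" E C] by auto
qed

section \<open>Reading the answers from the root table\<close>

lemma stored_value_spec:
  "case result (stored_value w t) of enat k \<Rightarrow> (w, k) \<in> set t | \<infinity> \<Rightarrow> \<forall>k. (w, k) \<notin> set t"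
  by (induction w t rule: stored_value.induct) (auto split: enat.splits)

lemma least_other_value_result:
  "result (least_other_value w t) = (INF (v, k) \<in> {(v, k) \<in> set t. v \<noteq> w}. enat k)"
proof (induction t)
  case Nil
  show ?case by (simp add: top_enat_def)
next
  case (Cons p t)
  obtain v k where p: "p = (v, k)" by fastforce
  have *: "{(u, j) \<in> set (p # t). u \<noteq> w} =
      (if v \<noteq> w then {(v, k)} else {}) \<union> {(u, j) \<in> set t. u \<noteq> w}"
    by (auto simp: p)
  show ?case
    unfolding * INF_union Cons.IH[symmetric] by (auto simp: p inf_enat_def)
qed

lemma csl_constructive_result:
  assumes "tournament V E" "distinct (leaves c)" "set (leaves c) \<subseteq> V"
  shows "result (csl_constructive E C c w) = min_constructive E C c w"
\<comment> \<open>\<open>stored_value\<close> returns the first entry found for \<open>w\<close>; by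
  \<open>set_csl_table\<close> all entries of a team carry the same value.\<close>
proof (cases "result (csl_constructive E C c w)")
  case (enat k)
  then show ?thesis
    using stored_value_spec[of w "result (csl_table E C c)"] set_csl_table[OF assms]
    by (simp add: csl_constructive_def)
next
  case infinity
  then show ?thesis
    using stored_value_spec[of w "result (csl_table E C c)"] set_csl_table[OF assms]
    by (simp add: csl_constructive_def)
qed

text \<open>Leaves missing from the table have value \<infinity> and leave the minimum
  unchanged.\<close>

lemma csl_destructive_result:
  assumes "tournament V E" "distinct (leaves c)" "set (leaves c) \<subseteq> V"
  shows "result (csl_destructive E C c w) = (INF v \<in> set (leaves c) - {w}. min_constructive E C c v)"
proof -
  let ?t = "result (csl_table E C c)"
  have "(INF (v, k) \<in> {(v, k) \<in> set ?t. v \<noteq> w}. enat k) =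
      (INF v \<in> set (leaves c) - {w}. min_constructive E C c v)" (is "?a = ?b")
  proof (rule antisym)
    show "?a \<le> ?b"
    proof (rule INF_greatest)
      fix v assume v: "v \<in> set (leaves c) - {w}"
      show "?a \<le> min_constructive E C c v"
      proof (cases "min_constructive E C c v")
        case (enat k)
        then show ?thesis
          using v set_csl_table[OF assms] by (intro INF_lower2[of "(v, k)"]) auto
      qed simp
    qed
    show "?b \<le> ?a"
    proof (rule INF_greatest, clarify)
      fix v k assume "(v, k) \<in> set ?t" "v \<noteq> w"
      then have "min_constructive E C c v = enat k" "v \<in> set (leaves c) - {w}"
        using set_csl_table[OF assms] min_constructive_outside[of v c E C] by auto
      then show "?b \<le> enat k"
        by (metis INF_lower)
    qed
  qed
  then show ?thesis
    by (simp add: csl_destructive_def least_other_value_result)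
qed


section \<open>Running time\<close>

lemma steps_best_loser: "steps (best_loser E C v t) \<le> 3 * length t + 1"
  by (induction E C v t rule: best_loser.induct) auto

lemma steps_advance: "steps (advance E C t t' acc) \<le> length t * (3 * length t' + 2) + 1"
proof (induction E C t t' acc rule: advance.induct)
  case (2 E C v k t t' acc)
  then show ?case
    using steps_best_loser[of E C v t'] by (auto intro: add_mono[THEN order_trans])
qed simp

lemma length_advance: "length (result (advance E C t t' acc)) \<le> length t + length acc"
proof (induction t arbitrary: acc)
  case (Cons p t)
  obtain v k where "p = (v, k)" by fastforce
  then show ?case
    using Cons.IH[of acc] Cons.IH[of "(v, k + j) # acc" for j]
    by (auto split: option.splits intro: le_SucI)
qed simp

lemma length_csl_table: "length (result (csl_table E C c)) \<le> length (leaves c)"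
proof (induction c)
  case (Game l r)
  let ?tl = "result (csl_table E C l)" and ?tr = "result (csl_table E C r)"
  show ?case
    using Game length_advance[of E C ?tl ?tr "[]"]
      length_advance[of E C ?tr ?tl "result (advance E C ?tl ?tr [])"] by simp
qed simp

text \<open>With \<open>a\<close> and \<open>b\<close> leaves below the children,
  \<open>6 * (a + b)^2\<close> exceeds \<open>6 * a^2 + 6 * b^2\<close> by
  \<open>12 * a * b\<close>, which pays for both calls of \<open>advance\<close>.\<close>

lemma steps_csl_table: "steps (csl_table E C c) \<le> 6 * (length (leaves c))\<^sup>2"
proof (induction c)
  case (Game l r)
  let ?tl = "result (csl_table E C l)" and ?tr = "result (csl_table E C r)"
  let ?a = "length (leaves l)" and ?b = "length (leaves r)"
  have pos: "1 \<le> ?a" "1 \<le> ?b"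
    using leaves_nonempty[of l] leaves_nonempty[of r] by (simp_all add: Suc_le_eq)
  have "steps (advance E C ?tl ?tr []) \<le> length ?tl * (3 * length ?tr + 2) + 1"
    by (rule steps_advance)
  also have "\<dots> \<le> ?a * (3 * ?b + 2) + 1"
    by (intro add_mono mult_mono length_csl_table) auto
  finally have A: "steps (advance E C ?tl ?tr []) \<le> ?a * (3 * ?b + 2) + 1" .
  have "steps (advance E C ?tr ?tl acc) \<le> length ?tr * (3 * length ?tl + 2) + 1" for acc
    by (rule steps_advance)
  also have "\<dots> \<le> ?b * (3 * ?a + 2) + 1"
    by (intro add_mono mult_mono length_csl_table) auto
  finally have B: "steps (advance E C ?tr ?tl acc) \<le> ?b * (3 * ?a + 2) + 1" for acc .
  \<comment> \<open>Each of \<open>a\<close>, \<open>b\<close> and 1 is at most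
    \<open>a * b\<close>, so the lower-order terms cost at most 2 + 2 + 2 products besides the
    leading 6, giving 12.\<close>
  have "?a * 1 \<le> ?a * ?b" "1 * ?b \<le> ?a * ?b" "1 * 1 \<le> ?a * ?b"
    by (rule mult_le_mono[OF order_refl pos(2)], rule mult_le_mono[OF pos(1) order_refl],
        rule mult_le_mono[OF pos])
  moreover have "?a * (3 * ?b + 2) + 1 + (?b * (3 * ?a + 2) + 1) =
      6 * (?a * ?b) + 2 * ?a + 2 * ?b + 2"
    by (simp add: algebra_simps)
  ultimately have "?a * (3 * ?b + 2) + 1 + (?b * (3 * ?a + 2) + 1) \<le> 12 * (?a * ?b)"
    by linarith
  then show ?case
    using Game A B[of "result (advance E C ?tl ?tr [])"]
    by (simp add: power2_eq_square algebra_simps)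
qed simp

lemma steps_stored_value: "steps (stored_value w t) \<le> 2 * length t + 1"
  by (induction t) auto

lemma steps_least_other_value: "steps (least_other_value w t) \<le> 2 * length t + 1"
  by (induction t) auto

text \<open>The quadratic term pays for the table, the rest for the final scan of at most one row
  per leaf.\<close>

lemma steps_csl:
  "steps (csl_constructive E C c w) \<le> poly [:1, 2, 6:] (length (leaves c))"
  "steps (csl_destructive E C c w) \<le> poly [:1, 2, 6:] (length (leaves c))"
  using steps_csl_table[of E C c] length_csl_table[of E C c]
    steps_stored_value[of w "result (csl_table E C c)"]
    steps_least_other_value[of w "result (csl_table E C c)"]
  by (simp_all add: csl_constructive_def csl_destructive_def power2_eq_square algebra_simps)

theorem theorem5:
  shows "\<exists>p :: nat poly. \<forall>(V :: 'v set) E C c w.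
    tournament V E \<and> cup_over V c \<and> C \<subseteq> V \<and> w \<in> V \<longrightarrow>
      result (csl_constructive E C c w) = m_value E C c w \<and>
      result (csl_constructive E C c w) = min_constructive E C c w \<and>
      steps (csl_constructive E C c w) \<le> poly p (card V) \<and>
      result (csl_destructive E C c w) = (INF v \<in> V - {w}. m_value E C c v) \<and>
      result (csl_destructive E C c w) = min_destructive E C c w \<and>
      steps (csl_destructive E C c w) \<le> poly p (card V)"
proof (rule exI[of _ "[:1, 2, 6:]"], intro allI impI)
  fix V :: "'v set" and E C c w
  assume "tournament V E \<and> cup_over V c \<and> C \<subseteq> V \<and> w \<in> V"
  then have E: "tournament V E" and c: "distinct (leaves c)" and V: "set (leaves c) = V"
    and w: "w \<in> V"
    by (auto simp: cup_over_def)
  \<comment> \<open>The leaves list each team once, so bounds in the number of leaves are bounds in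
    the number of teams.\<close>
  have card: "card V = length (leaves c)"
    using c V distinct_card by metis
  have m: "m_value E C c v = min_constructive E C c v" if "v \<in> V" for v
    using m_value_eq_min_constructive[OF E c] V that by simp
  then have "(INF v \<in> V - {w}. m_value E C c v) = (INF v \<in> V - {w}. min_constructive E C c v)"
    by (intro INF_cong) auto
  then show "result (csl_constructive E C c w) = m_value E C c w \<and>
      result (csl_constructive E C c w) = min_constructive E C c w \<and>
      steps (csl_constructive E C c w) \<le> poly [:1, 2, 6:] (card V) \<and>
      result (csl_destructive E C c w) = (INF v \<in> V - {w}. m_value E C c v) \<and>
      result (csl_destructive E C c w) = min_destructive E C c w \<and>
      steps (csl_destructive E C c w) \<le> poly [:1, 2, 6:] (card V)"
    using csl_constructive_result[OF E c] csl_destructive_result[OF E c] m[OF w] V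
      min_destructive_eq_INF[of E C c w] steps_csl[of E C c w] card by simp
qed

end
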